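(* Let $X=Y^\star$, $P$, $j$, $A$, $S$ and the families $\{q_t\}_{0<t<t_0}$, $\{\bar x_t\}_{0\le t<t_0}$, the direction $q$, the operators $A_p,A_x$ and the difference quotients $y_t=(\bar x_t-\bar x_0)/t$ be as in the context, and set $a_0:=-A(0,\bar x_0)$. Suppose that one of the following conditions is satisfied. (i) $j$ is weakly-$\star$ twice epi-differentiable in $\bar x_0$ for $a_0$, and $A_x$ is weakly-$\star$ completely continuous in the sense that $y_n\stackrel{\star}{\rightharpoonup}y$ in $X$ implies $A_xy_n\to A_xy$ in $Y$. (ii) $j$ is strongly twice epi-differentiable in $\bar x_0$ for $a_0$, and $A_x$ is such that $y_n\stackrel{\star}{\rightharpoonup}y$ in $X$ implies $A_xy_n\rightharpoonup A_xy$ in $Y$ and $\liminf_{n\to\infty}\langle A_xy_n,y_n\rangle\ge\langle A_xy,y\rangle$. Then the family of difference quotients $y_t$ has at least one weak-$\star$ accumulation point for $t\searrow0$ (i.e. there are $y\in X$ and $t_n\searrow0$ with $y_{t_n}\stackrel{\star}{\rightharpoonup}y$), and if $y\in X$ is such an accumulation point, then $$\langle A_pq+A_xy,z-y\rangle+\tfrac12Q_j^{\bar x_0,a_0}(z)-\tfrac12Q_j^{\bar x_0,a_0}(y)\ge0\qquad\forall z\in X\qquad(\ast)$$ holds and $\langle A_xy_{t_n},y_{t_n}\rangle\to\langle A_xy,y\rangle$ for every sequence $\{t_n\}\subset(0,\infty)$ with $t_n\searrow0$ and $y_{t_n}\stackrel{\star}{\rightharpoonup}y$. If, moreover, $(\ast)$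 admits at most one solution $y$, then there exists a unique $y\in X$ with $y_t\stackrel{\star}{\rightharpoonup}y$ and $\langle A_xy_t,y_t\rangle\to\langle A_xy,y\rangle$ for $t\searrow0$, and this limit $y$ is a solution to $(\ast)$.
   Context: Setting: $Y$ is a (real) Banach space that is reflexive or separable, $X=Y^\star$ is its topological dual, $\langle\cdot,\cdot\rangle$ is the dual pairing between $Y$ and $X$, $P$ is a normed vector space, $j:X\to(-\infty,\infty]$ is proper ($j\not\equiv\infty$, not necessarily convex), $\operatorname{dom}(j)=\{x\in X: j(x)\in\mathbb R\}$, and $A:P\times X\to Y$ is a mapping. For $p\in P$, $S(p)$ is the (possibly empty or non-singleton) set of all $\bar x\in\operatorname{dom}(j)$ with $\langle A(p,\bar x),x-\bar x\rangle+j(x)-j(\bar x)\ge0$ for all $x\in X$. Standing assumptions on the families: for some $t_0>0$ there are given $\{q_t\}_{0<t<t_0}\subset P$ and $\{\bar x_t\}_{0\le t<t_0}\subset X$ such that (1) $q_t\to q$ in $P$ for $t\searrow0$ with some $q\in P$; (2) $\bar x_t\in S(tq_t)$ for all $0<t<t_0$, $\bar x_0\in S(0)$, and there is $L>0$ with $\|\bar x_t-\bar x_0\|_X\le Lt$ for all $t\in[0,t_0)$; (3) there are bounded linear operators $A_p\in\mathcal L(P,Y)$, $A_x\in\mathcal L(X,Y)$ such that $y_t:=(\bar x_t-\bar x_0)/t$ satisfies $A(tq_t,\bar x_0+ty_t)=A(0,\bar x_0)+tA_pq_t+tA_xy_t+r(t)$ for $0<t<t_0$, with $r:(0,t_0)\to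 Y$ satisfying $\|r(t)\|_Y/t\to0$ as $t\searrow0$. Weak-$\star$ second subderivative: for $x\in\operatorname{dom}(j)$, $g\in Y$, the functional $Q_j^{x,g}:X\to[-\infty,\infty]$ is $$Q_j^{x,g}(z):=\inf\Big\{\liminf_{n\to\infty}\frac{j(x+t_nz_n)-j(x)-t_n\langle g,z_n\rangle}{t_n^2/2}\ \Big|\ t_n\searrow0,\ z_n\stackrel{\star}{\rightharpoonup}z\Big\}.$$ (For $g=a_0\in Y$ as in the claim one has $Q_j^{\bar x_0,a_0}\ge 0$ and $Q_j^{\bar x_0,a_0}(0)=0$; a solution $y$ of $(\ast)$ is understood to satisfy $Q_j^{\bar x_0,a_0}(y)<\infty$.) Second-order epi-differentiability: $j$ is weakly-$\star$ (respectively strongly) twice epi-differentiable in $x\in\operatorname{dom}(j)$ for $g\in Y$ if for every $z\in X$ and every $\{t_n\}\subset(0,\infty)$ with $t_n\searrow0$ there is a sequence $\{z_n\}\subset X$ with $z_n\stackrel{\star}{\rightharpoonup}z$ (respectively $z_n\to z$ in norm) and $Q_j^{x,g}(z)=\lim_{n\to\infty}\frac{j(x+t_nz_n)-j(x)-t_n\langle g,z_n\rangle}{t_n^2/2}$. *)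

theory Defs
  imports "HOL-Analysis.Analysis"
begin

text \<open>
  \<open>Y\<close> is a type of class \<^class>\<open>banach\<close> and \<open>X\<close> is its topological dual
  \<open>'y \<Rightarrow>\<^sub>L real\<close>; the pairing of \<open>g \<in> Y\<close> with \<open>z \<in> X\<close> is \<open>blinfun_apply z g\<close>.
\<close>

abbreviation pairing :: "'y::real_normed_vector \<Rightarrow> ('y \<Rightarrow>\<^sub>L real) \<Rightarrow> real"
    (\<open>(\<open>notation=\<open>mixfix pairing\<close>\<close>\<langle>_,/ _\<rangle>)\<close>)
  where "\<langle>g, z\<rangle> \<equiv> blinfun_apply z g"

text \<open>Surjectivity of the canonical embedding into the bidual.\<close>

definition reflexive_space :: "'y::real_normed_vector itself \<Rightarrow> bool" where
  "reflexive_space _ \<longleftrightarrow>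
     (\<forall>\<phi> :: ('y \<Rightarrow>\<^sub>L real) \<Rightarrow>\<^sub>L real. \<exists>v :: 'y. \<forall>x. blinfun_apply \<phi> x = \<langle>v, x\<rangle>)"

text \<open>
  For real-valued operators the strong operator topology is the topology of pointwise convergence
  on \<open>Y\<close>, which is the weak-star topology of \<open>X\<close>.
\<close>

definition weak_star_lim ::
    "('i \<Rightarrow> ('y::real_normed_vector \<Rightarrow>\<^sub>L real)) \<Rightarrow> ('y \<Rightarrow>\<^sub>L real) \<Rightarrow> 'i filter \<Rightarrow> bool" where
  "weak_star_lim f l F \<longleftrightarrow> limitin strong_operator_topology f l F"

lemma weak_star_lim_iff:
  "weak_star_lim f l F \<longleftrightarrow> (\<forall>v. ((\<lambda>i. \<langle>v, f i\<rangle>) \<longlongrightarrow> \<langle>v, l\<rangle>) F)"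
proof
  assume L: "weak_star_lim f l F"
  show "\<forall>v. ((\<lambda>i. \<langle>v, f i\<rangle>) \<longlongrightarrow> \<langle>v, l\<rangle>) F"
  proof
    fix v
    have "limitin euclidean ((\<lambda>g. blinfun_apply g v) \<circ> f) (blinfun_apply l v) F"
      using continuous_map_limit[OF strong_operator_topology_continuous_evaluation]
        L[unfolded weak_star_lim_def] by blast
    then show "((\<lambda>i. \<langle>v, f i\<rangle>) \<longlongrightarrow> \<langle>v, l\<rangle>) F"
      by (simp add: o_def)
  qed
next
  assume P: "\<forall>v. ((\<lambda>i. \<langle>v, f i\<rangle>) \<longlongrightarrow> \<langle>v, l\<rangle>) F"
  have T: "limitin (product_topology (\<lambda>i. euclidean) UNIV)
             (\<lambda>i. blinfun_apply (f i)) (blinfun_apply l) F"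
    using P by (simp add: limitin_componentwise)
  show "weak_star_lim f l F"
    unfolding weak_star_lim_def limitin_def
  proof (intro conjI allI impI)
    show "l \<in> topspace strong_operator_topology"
      by (simp add: strong_operator_topology_topspace)
    fix U :: "('b \<Rightarrow>\<^sub>L real) set"
    assume U: "openin strong_operator_topology U \<and> l \<in> U"
    then obtain V where V: "open V" "U = blinfun_apply -` V"
      by (auto simp: strong_operator_topology_def openin_pullback_topology)
    then have "openin (product_topology (\<lambda>i. euclidean) UNIV) V"
      by (simp add: open_fun_def)
    then have "\<forall>\<^sub>F i in F. blinfun_apply (f i) \<in> V"
      using T U V by (auto simp: limitin_def)
    then show "\<forall>\<^sub>F i in F. f i \<in> U"
      using V by simp
  qed
qed

definition weak_lim ::
    "('i \<Rightarrow> 'y::real_normed_vector) \<Rightarrow> 'y \<Rightarrow> 'i filter \<Rightarrow> bool" where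
  "weak_lim f l F \<longleftrightarrow> (\<forall>\<phi> :: 'y \<Rightarrow>\<^sub>L real. ((\<lambda>i. \<langle>f i, \<phi>\<rangle>) \<longlongrightarrow> \<langle>l, \<phi>\<rangle>) F)"

text \<open>The sequences written \<open>t\<^sub>n \<searrow> 0\<close>; they need not be monotone.\<close>

definition pos_null_seq :: "(nat \<Rightarrow> real) \<Rightarrow> bool" where
  "pos_null_seq t \<longleftrightarrow> (\<forall>n. 0 < t n) \<and> t \<longlonglongrightarrow> 0"

definition proper_fun :: "('x \<Rightarrow> ereal) \<Rightarrow> bool" where
  "proper_fun j \<longleftrightarrow> (\<forall>x. j x \<noteq> -\<infinity>) \<and> (\<exists>x. j x \<noteq> \<infinity>)"

definition edom :: "('x \<Rightarrow> ereal) \<Rightarrow> 'x set" where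
  "edom j = {x. \<bar>j x\<bar> \<noteq> \<infinity>}"

definition VI_solutions ::
    "('y::real_normed_vector \<Rightarrow>\<^sub>L real \<Rightarrow> ereal) \<Rightarrow>
     ('p \<Rightarrow> ('y \<Rightarrow>\<^sub>L real) \<Rightarrow> 'y) \<Rightarrow> 'p \<Rightarrow> ('y \<Rightarrow>\<^sub>L real) set" where
  "VI_solutions j A p =
     {xb \<in> edom j. \<forall>x. ereal \<langle>A p xb, x - xb\<rangle> + j x - j xb \<ge> 0}"

definition second_quot ::
    "('y::real_normed_vector \<Rightarrow>\<^sub>L real \<Rightarrow> ereal) \<Rightarrow> ('y \<Rightarrow>\<^sub>L real) \<Rightarrow> 'y \<Rightarrow>
     real \<Rightarrow> ('y \<Rightarrow>\<^sub>L real) \<Rightarrow> ereal" where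
  "second_quot j x g t z =
     (j (x + t *\<^sub>R z) - j x - ereal (t * \<langle>g, z\<rangle>)) / ereal (t\<^sup>2 / 2)"

definition second_subderiv ::
    "('y::real_normed_vector \<Rightarrow>\<^sub>L real \<Rightarrow> ereal) \<Rightarrow> ('y \<Rightarrow>\<^sub>L real) \<Rightarrow> 'y \<Rightarrow>
     ('y \<Rightarrow>\<^sub>L real) \<Rightarrow> ereal" where
  "second_subderiv j x g z =
     Inf {liminf (\<lambda>n. second_quot j x g (t n) (zs n)) | t zs.
            pos_null_seq t \<and> weak_star_lim zs z sequentially}"

definition weak_star_twice_epi_diff ::
    "('y::real_normed_vector \<Rightarrow>\<^sub>L real \<Rightarrow> ereal) \<Rightarrow> ('y \<Rightarrow>\<^sub>L real) \<Rightarrow> 'y \<Rightarrow> bool" where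
  "weak_star_twice_epi_diff j x g \<longleftrightarrow>
     (\<forall>z t. pos_null_seq t \<longrightarrow>
        (\<exists>zs. weak_star_lim zs z sequentially \<and>
              (\<lambda>n. second_quot j x g (t n) (zs n)) \<longlonglongrightarrow> second_subderiv j x g z))"

definition strong_twice_epi_diff ::
    "('y::real_normed_vector \<Rightarrow>\<^sub>L real \<Rightarrow> ereal) \<Rightarrow> ('y \<Rightarrow>\<^sub>L real) \<Rightarrow> 'y \<Rightarrow> bool" where
  "strong_twice_epi_diff j x g \<longleftrightarrow>
     (\<forall>z t. pos_null_seq t \<longrightarrow>
        (\<exists>zs. zs \<longlonglongrightarrow> z \<and>
              (\<lambda>n. second_quot j x g (t n) (zs n)) \<longlonglongrightarrow> second_subderiv j x g z))"

definition weak_star_completely_continuous ::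
    "(('y::real_normed_vector \<Rightarrow>\<^sub>L real) \<Rightarrow>\<^sub>L 'y) \<Rightarrow> bool" where
  "weak_star_completely_continuous B \<longleftrightarrow>
     (\<forall>ys y. weak_star_lim ys y sequentially \<longrightarrow> (\<lambda>n. B (ys n)) \<longlonglongrightarrow> B y)"

definition weak_star_weak_continuous_lsc ::
    "(('y::real_normed_vector \<Rightarrow>\<^sub>L real) \<Rightarrow>\<^sub>L 'y) \<Rightarrow> bool" where
  "weak_star_weak_continuous_lsc B \<longleftrightarrow>
     (\<forall>ys y. weak_star_lim ys y sequentially \<longrightarrow>
        weak_lim (\<lambda>n. B (ys n)) (B y) sequentially \<and>
        liminf (\<lambda>n. ereal \<langle>B (ys n), ys n\<rangle>) \<ge> ereal \<langle>B y, y\<rangle>)"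

definition weak_star_acc_point ::
    "real \<Rightarrow> (real \<Rightarrow> ('y::real_normed_vector \<Rightarrow>\<^sub>L real)) \<Rightarrow> ('y \<Rightarrow>\<^sub>L real) \<Rightarrow> bool" where
  "weak_star_acc_point t0 ys y \<longleftrightarrow>
     (\<exists>t. pos_null_seq t \<and> (\<forall>n. t n < t0) \<and> weak_star_lim (\<lambda>n. ys (t n)) y sequentially)"

text \<open>
  The linearised variational inequality with data \<open>b = A\<^sub>p q\<close>, \<open>B = A\<^sub>x\<close> and \<open>Q\<close> the second
  subderivative.  The condition \<open>Q y < \<infinity>\<close> is part of the notion of a solution; it keeps the
  difference of extended reals free of \<open>\<infinity> - \<infinity>\<close> (which is \<open>\<infinity>\<close> in \<^typ>\<open>ereal\<close>).
\<close>

definition linearised_VI_solution ::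
    "'y::real_normed_vector \<Rightarrow> (('y \<Rightarrow>\<^sub>L real) \<Rightarrow>\<^sub>L 'y) \<Rightarrow>
     (('y \<Rightarrow>\<^sub>L real) \<Rightarrow> ereal) \<Rightarrow> ('y \<Rightarrow>\<^sub>L real) \<Rightarrow> bool" where
  "linearised_VI_solution b B Q y \<longleftrightarrow>
     Q y < \<infinity> \<and>
     (\<forall>z. ereal \<langle>b + B y, z - y\<rangle> + ereal (1/2) * Q z - ereal (1/2) * Q y \<ge> 0)"

end

theory Submission
  imports Defs "HOL-Library.Diagonal_Subsequence"
begin

text \<open>
  Testing the variational inequality for \<open>xb t\<close> with \<open>xb 0 + t z\<close> and dividing by \<open>t\<^sup>2\<close> gives, with
  \<open>b\<^sub>t = Ap (qt t) + r t / t\<close> and the second-order quotient \<open>Q\<^sub>t\<close> of \<open>j\<close>,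
  \<open>\<langle>b\<^sub>t + Ax y\<^sub>t, y\<^sub>t\<rangle> + Q\<^sub>t(y\<^sub>t) / 2 \<le> \<langle>b\<^sub>t + Ax y\<^sub>t, z\<rangle> + Q\<^sub>t(z) / 2\<close> for all \<open>z\<close>.
  Along a weak-star convergent sequence \<open>y\<^sub>t \<rightarrow> \<eta>\<close> the lower limit on the left is bounded from below by the
  definition of \<open>Q\<close>, and recovery sequences for \<open>z\<close> give the limit on the right; \<open>z = 0\<close> shows
  \<open>Q \<eta> < \<infinity>\<close>, and \<open>z = \<eta>\<close> gives convergence of \<open>\<langle>Ax y\<^sub>t, y\<^sub>t\<rangle>\<close>.  Case (i) is reduced to the
  semicontinuity used in case (ii).  Accumulation points exist because bounded
  sequences in the dual of a separable or reflexive space have weak-star convergent subsequences.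
\<close>

section \<open>The Hahn-Banach theorem\<close>

text \<open>For positive scalars only an inequality is demanded, which is the form that passes
  directly to infima; equality comes back by scaling with \<open>1/c\<close>.\<close>

definition sublinear :: "('a::real_vector \<Rightarrow> real) \<Rightarrow> bool" where
  "sublinear p \<longleftrightarrow> (\<forall>x y. p (x + y) \<le> p x + p y) \<and> (\<forall>c>0. \<forall>x. p (c *\<^sub>R x) \<le> c * p x)"

lemma sublinear_add: "sublinear p \<Longrightarrow> p (x + y) \<le> p x + p y"
  by (simp add: sublinear_def)

lemma sublinear_scale:
  assumes "sublinear p" "c > 0"
  shows "p (c *\<^sub>R x) = c * p x"
proof (rule antisym)
  show "p (c *\<^sub>R x) \<le> c * p x"
    using assms by (simp add: sublinear_def)
  have "p ((1/c) *\<^sub>R (c *\<^sub>R x)) \<le> (1/c) * p (c *\<^sub>R x)"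
    using assms unfolding sublinear_def by (meson divide_pos_pos zero_less_one)
  then show "c * p x \<le> p (c *\<^sub>R x)"
    using assms by (simp add: field_simps)
qed

lemma sublinear_0: "sublinear p \<Longrightarrow> p 0 = 0"
  using sublinear_scale[of p 2 0] by simp

lemma sublinear_minus: "sublinear p \<Longrightarrow> - p (- x) \<le> p x"
  using sublinear_add[of p x "- x"] sublinear_0[of p] by simp

text \<open>
  Minimal sublinear functionals are linear: by minimality the reduction \<open>p'\<close> below coincides with
  \<open>p\<close>, so \<open>p x + p v \<le> p (x + v)\<close>.
\<close>

lemma sublinear_reduction:
  fixes v :: "'a::real_vector"
  assumes p: "sublinear p"
  obtains p' where "sublinear p'" "\<And>x. p' x \<le> p x" "\<And>x. p' x \<le> p (x + v) - p v"
proof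
  define h where "h = (\<lambda>x t. p (x + t *\<^sub>R v) - t * p v)"
  define p' where "p' = (\<lambda>x. INF t\<in>{0..}. h x t)"
  \<comment> \<open>This lower bound, uniform in \<open>t\<close>, makes the infimum
    \<open>p'\<close> finite: \<open>t * p v = p (t *\<^sub>R v)\<close> is split as
    \<open>(x + t *\<^sub>R v) + (- x)\<close>.\<close>
  have low: "- p (- x) \<le> h x t" if "t \<ge> 0" for x t
  proof -
    have "p (t *\<^sub>R v) = t * p v"
      using sublinear_scale[OF p, of t v] sublinear_0[OF p] that by (cases "t = 0") auto
    then show ?thesis
      using sublinear_add[OF p, of "x + t *\<^sub>R v" "- x"] by (simp add: h_def)
  qed
  have bdd: "bdd_below (h x ` {0..})" for x
    by (rule bdd_belowI2[of _ "- p (- x)"]) (simp add: low)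
  have le: "p' x \<le> h x t" if "t \<ge> 0" for x t
    unfolding p'_def using that by (intro cINF_lower bdd) auto
  have greatest: "m \<le> p' x" if "\<And>t. t \<ge> 0 \<Longrightarrow> m \<le> h x t" for m x
    unfolding p'_def using that by (intro cINF_greatest) auto
  show "p' x \<le> p x" "p' x \<le> p (x + v) - p v" for x
    using le[of 0 x] le[of 1 x] by (auto simp: h_def)
  show "sublinear p'"
    unfolding sublinear_def
  proof (intro conjI allI impI)
    fix x y
    \<comment> \<open>The parameters \<open>s\<close> and \<open>t\<close> are independent, since
      \<open>s + t\<close> is admissible for \<open>x + y\<close>; the infima can therefore be taken
      one after the other.\<close>
    have "p' (x + y) \<le> h x s + h y t" if "s \<ge> 0" "t \<ge> 0" for s t
      using le[of "s + t" "x + y"] that sublinear_add[OF p, of "x + s *\<^sub>R v" "y + t *\<^sub>R v"]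
      by (simp add: h_def algebra_simps)
    then have "p' (x + y) - h x s \<le> p' y" if "s \<ge> 0" for s
      using that by (intro greatest) (simp add: algebra_simps)
    then have "p' (x + y) - p' y \<le> p' x"
      by (intro greatest) (simp add: algebra_simps)
    then show "p' (x + y) \<le> p' x + p' y" by simp
  next
    fix c :: real and x assume c: "c > 0"
    have "p' (c *\<^sub>R x) \<le> c * h x t" if "t \<ge> 0" for t
      using le[of "c * t" "c *\<^sub>R x"] that c sublinear_scale[OF p c, of "x + t *\<^sub>R v"]
      by (simp add: h_def algebra_simps)
    then have "p' (c *\<^sub>R x) / c \<le> p' x"
      using c by (intro greatest) (simp add: field_simps)
    then show "p' (c *\<^sub>R x) \<le> c * p' x"
      using c by (simp add: field_simps)
  qed
qed

text \<open>Zorn's lemma for the reversed pointwise order on the sublinear functionals below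
  \<open>p\<close>. A nonempty chain is bounded by its pointwise infimum, which is finite because
  \<open>- p (- x)\<close> bounds every member from below.\<close>

lemma sublinear_minimal:
  assumes p: "sublinear p"
  obtains m where "sublinear m" "\<And>x. m x \<le> p x"
    "\<And>s. sublinear s \<Longrightarrow> (\<And>x. s x \<le> m x) \<Longrightarrow> s = m"
proof -
  define S where "S = {s. sublinear s \<and> s \<le> p}"
  have "\<exists>m\<in>S. \<forall>s\<in>S. m \<ge> s \<longrightarrow> s = m"
  proof (rule predicate_Zorn[of S "(\<ge>)"])
    show "partial_order_on S (relation_of (\<ge>) S)"
      by (rule partial_order_on_relation_ofI) auto
  next
    fix C assume C: "C \<in> Chains (relation_of (\<ge>) S)"
    then have CS: "C \<subseteq> S" and total: "s \<le> s' \<or> s' \<le> s" if "s \<in> C" "s' \<in> C" for s s'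
      using that by (auto simp: Chains_def relation_of_def)
    show "\<exists>u\<in>S. \<forall>s\<in>C. s \<ge> u"
    proof (cases "C = {}")
      case True
      then show ?thesis using p by (auto simp: S_def)
    next
      case False
      define u where "u = (\<lambda>x. INF s\<in>C. s x)"
      have sub: "sublinear s" "s x \<le> p x" if "s \<in> C" for s x
        using CS[OF that that] that by (auto simp: S_def le_fun_def)
      have bdd: "bdd_below ((\<lambda>s. s x) ` C)" for x
        by (rule bdd_belowI2[of _ "- p (- x)"])
          (meson sub sublinear_minus neg_le_iff_le order_trans)
      have le: "u x \<le> s x" if "s \<in> C" for s x
        unfolding u_def using that by (intro cINF_lower bdd)
      have greatest: "k \<le> u x" if "\<And>s. s \<in> C \<Longrightarrow> k \<le> s x" for k x
        unfolding u_def using False that by (intro cINF_greatest) auto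
      have "sublinear u"
        unfolding sublinear_def
      proof (intro conjI allI impI)
        fix x y
        have "u (x + y) - s x \<le> s' y" if ss: "s \<in> C" "s' \<in> C" for s s'
        proof -
          \<comment> \<open>Two different members \<open>s\<close> and \<open>s'\<close> have to be
            compared at once; the smaller of the two lies below both, and its own subadditivity
            suffices.\<close>
          obtain a where a: "a \<in> C" "a \<le> s" "a \<le> s'"
            using total[OF ss] ss by blast
          have "u (x + y) \<le> a (x + y)"
            by (rule le) fact
          also have "\<dots> \<le> a x + a y"
            using sub(1)[OF a(1)] by (rule sublinear_add)
          also have "\<dots> \<le> s x + s' y"
            using a(2,3) by (intro add_mono) (auto simp: le_fun_def)
          finally show ?thesis by simp
        qed
        then have "u (x + y) - s x \<le> u y" if "s \<in> C" for s
          using that by (intro greatest)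
        then have "u (x + y) - u y \<le> u x"
          by (intro greatest) (simp add: algebra_simps)
        then show "u (x + y) \<le> u x + u y" by simp
      next
        fix c :: real and x assume c: "c > 0"
        have "u (c *\<^sub>R x) / c \<le> u x"
        proof (rule greatest)
          fix s assume s: "s \<in> C"
          show "u (c *\<^sub>R x) / c \<le> s x"
            using le[OF s, of "c *\<^sub>R x"] sublinear_scale[OF sub(1)[OF s] c, of x] c
            by (simp add: field_simps)
        qed
        then show "u (c *\<^sub>R x) \<le> c * u x"
          using c by (simp add: field_simps)
      qed
      moreover have "u \<le> p"
      proof -
        obtain s where "s \<in> C" using False by blast
        then show ?thesis
          using le[of s] sub(2)[of s] by (auto simp: le_fun_def intro: order_trans)
      qed
      ultimately show ?thesis
        using le by (auto simp: S_def le_fun_def)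
    qed
  qed
  then obtain m where "m \<in> S" "\<And>s. s \<in> S \<Longrightarrow> s \<le> m \<Longrightarrow> s = m" by blast
  then have "sublinear m" "\<And>x. m x \<le> p x"
    "\<And>s. sublinear s \<Longrightarrow> (\<And>x. s x \<le> m x) \<Longrightarrow> s = m"
    by (auto simp: S_def le_fun_def) (meson order_trans)
  then show thesis by (rule that)
qed

text \<open>The functional is minimal below \<open>p0\<close>, the reduction of \<open>p\<close> in
  direction \<open>v\<close>, rather than below \<open>p\<close> itself. Minimality gives linearity,
  while \<open>p0 (- v) \<le> p 0 - p v = - p v\<close> forces the value \<open>p v\<close> at
  \<open>v\<close>.\<close>

theorem Hahn_Banach_sublinear:
  fixes v :: "'a::real_vector"
  assumes p: "sublinear p"
  obtains f where "linear f" "\<And>x. f x \<le> p x" "f v = p v"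
proof -
  obtain p0 where p0: "sublinear p0" "\<And>x. p0 x \<le> p x" "\<And>x. p0 x \<le> p (x + v) - p v"
    using sublinear_reduction[OF p, of v] by blast
  obtain f where f: "sublinear f" "\<And>x. f x \<le> p0 x"
    and min: "\<And>s. sublinear s \<Longrightarrow> (\<And>x. s x \<le> f x) \<Longrightarrow> s = f"
    using sublinear_minimal[OF p0(1)] by blast
  have add: "f (x + y) = f x + f y" for x y
  proof -
    obtain s where "sublinear s" "\<And>x. s x \<le> f x" "\<And>x. s x \<le> f (x + y) - f y"
      using sublinear_reduction[OF f(1), of y] by blast
    then have "f x \<le> f (x + y) - f y"
      using min[of s] by metis
    then show ?thesis
      using sublinear_add[OF f(1), of x y] by simp
  qed
  have neg: "f (- x) = - f x" for x
    using add[of x "- x"] sublinear_0[OF f(1)] by simp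
  have scale: "f (c *\<^sub>R x) = c * f x" for c x
  proof (cases c "0::real" rule: linorder_cases)
    case less
    then show ?thesis
      using sublinear_scale[OF f(1), of "- c" x] neg[of "c *\<^sub>R x"] by simp
  next
    case equal
    then show ?thesis using sublinear_0[OF f(1)] by simp
  next
    case greater
    then show ?thesis by (rule sublinear_scale[OF f(1)])
  qed
  show thesis
  proof
    show "linear f" by (rule linearI) (auto simp: add scale)
    show "f x \<le> p x" for x using f(2) p0(2) by (rule order_trans)
    have "f (- v) \<le> - p v"
      using f(2)[of "- v"] p0(3)[of "- v"] sublinear_0[OF p] by simp
    then show "f v = p v"
      using f(2)[of v] p0(2)[of v] by (simp add: neg)
  qed
qed

section \<open>Separation of a point from a closed subspace\<close>

lemma sublinear_infdist:
  fixes W :: "'a::real_normed_vector set"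
  assumes W: "subspace W"
  shows "sublinear (\<lambda>x. infdist x W)"
proof -
  have ne: "W \<noteq> {}" using subspace_0[OF W] by blast
  have greatest: "m \<le> infdist x W" if "\<And>w. w \<in> W \<Longrightarrow> m \<le> dist x w" for m x
    unfolding infdist_notempty[OF ne] using ne that by (intro cINF_greatest) auto
  show ?thesis
    unfolding sublinear_def
  proof (intro conjI allI impI)
    fix x y
    have "infdist (x + y) W \<le> dist x a + dist y b" if "a \<in> W" "b \<in> W" for a b
    proof -
      have "infdist (x + y) W \<le> dist (x + y) (a + b)"
        using subspace_add[OF W that] by (rule infdist_le)
      also have "\<dots> \<le> dist x a + dist y b"
        by (rule dist_triangle_add)
      finally show ?thesis .
    qed
    then have "infdist (x + y) W - dist x a \<le> infdist y W" if "a \<in> W" for a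
      using that by (intro greatest) (simp add: algebra_simps)
    then have "infdist (x + y) W - infdist y W \<le> infdist x W"
      by (intro greatest) (simp add: algebra_simps)
    then show "infdist (x + y) W \<le> infdist x W + infdist y W" by simp
  next
    fix c :: real and x assume c: "c > 0"
    have "infdist (c *\<^sub>R x) W / c \<le> infdist x W"
    proof (rule greatest)
      fix w assume "w \<in> W"
      then have "infdist (c *\<^sub>R x) W \<le> dist (c *\<^sub>R x) (c *\<^sub>R w)"
        using W by (intro infdist_le) (simp add: subspace_scale)
      also have "\<dots> = c * dist x w"
        using c norm_scaleR[of c "x - w"] by (simp add: dist_norm scaleR_diff_right del: norm_scaleR)
      finally show "infdist (c *\<^sub>R x) W / c \<le> dist x w"
        using c by (simp add: field_simps)
    qed
    then show "infdist (c *\<^sub>R x) W \<le> c * infdist x W"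
      using c by (simp add: field_simps)
  qed
qed

text \<open>The dominating sublinear functional is the distance to \<open>W\<close>. It vanishes on
  \<open>W\<close>, is at most the norm, and is positive at \<open>v\<close> because
  \<open>W\<close> is closed.\<close>

corollary Hahn_Banach_separation:
  fixes W :: "'a::real_normed_vector set"
  assumes W: "subspace W" "closed W" and v: "v \<notin> W"
  obtains f :: "'a \<Rightarrow>\<^sub>L real" where "\<And>w. w \<in> W \<Longrightarrow> f w = 0" "f v \<noteq> 0"
proof -
  obtain g where lin: "linear g" and g: "\<And>x. g x \<le> infdist x W" "g v = infdist v W"
    using Hahn_Banach_sublinear[OF sublinear_infdist[OF W(1)]] by blast
  \<comment> \<open>One estimate serves twice: \<open>w = 0\<close> gives boundedness of
    \<open>g\<close>, and \<open>x = w\<close> gives \<open>g = 0\<close> on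
    \<open>W\<close>.\<close>
  have abs: "\<bar>g x\<bar> \<le> dist x w" if "w \<in> W" for x w
  proof -
    have "- w \<in> W" using W(1) that by (rule subspace_neg)
    then have "infdist (- x) W \<le> dist (- x) (- w)"
      by (rule infdist_le)
    then show ?thesis
      using g(1)[of x] g(1)[of "- x"] infdist_le[OF that, of x] linear_neg[OF lin, of x]
      by (auto simp: dist_minus)
  qed
  have "bounded_linear g"
    using lin abs[OF subspace_0[OF W(1)]]
    by (intro bounded_linear_intro[where K = 1]) (auto simp: linear_add linear_scale)
  then have app: "blinfun_apply (Blinfun g) = g"
    by (rule bounded_linear_Blinfun_apply)
  show thesis
  proof
    show "blinfun_apply (Blinfun g) w = 0" if "w \<in> W" for w
      using abs[OF that, of w] by (simp add: app)
    show "blinfun_apply (Blinfun g) v \<noteq> 0"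
      using infdist_pos_not_in_closed[OF W(2) _ v] subspace_0[OF W(1)] g(2)
      by (force simp: app)
  qed
qed

section \<open>Closed spans and their countable dense subsets\<close>

lemma subspace_closure:
  fixes S :: "'a::real_normed_vector set"
  assumes S: "subspace S"
  shows "subspace (closure S)"
  unfolding subspace_def
proof (intro conjI ballI allI)
  show "0 \<in> closure S"
    using subspace_0[OF S] closure_subset by blast
next
  fix x y assume "x \<in> closure S" "y \<in> closure S"
  then obtain a b where "\<And>n. a n \<in> S" "a \<longlonglongrightarrow> x" "\<And>n. b n \<in> S" "b \<longlonglongrightarrow> y"
    by (auto simp: closure_sequential)
  then show "x + y \<in> closure S"
    unfolding closure_sequential
    by (intro exI[of _ "\<lambda>n. a n + b n"]) (auto intro: tendsto_add subspace_add[OF S])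
next
  fix c x assume "x \<in> closure S"
  then obtain a where "\<And>n. a n \<in> S" "a \<longlonglongrightarrow> x"
    by (auto simp: closure_sequential)
  then show "c *\<^sub>R x \<in> closure S"
    unfolding closure_sequential
    by (intro exI[of _ "\<lambda>n. c *\<^sub>R a n"]) (auto intro: tendsto_intros subspace_scale[OF S])
qed

text \<open>The dense set consists of the finite rational combinations of \<open>G\<close>. They are
  coded by lists of coefficient-vector pairs, so that countability is that of lists and a sum is the
  concatenation of lists.\<close>

lemma closure_span_countable_dense:
  fixes G :: "'a::real_normed_vector set"
  assumes G: "countable G"
  obtains D where "countable D" "closure D = closure (span G)"
proof -
  define ev :: "(rat \<times> 'a) list \<Rightarrow> 'a"
    where "ev = (\<lambda>l. \<Sum>(c, g)\<leftarrow>l. of_rat c *\<^sub>R g)"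
  define D where "D = ev ` lists (UNIV \<times> G)"
  have cD: "countable D"
    unfolding D_def using G by (intro countable_image countable_lists) auto
  have D_span: "D \<subseteq> span G"
  proof -
    have "ev l \<in> span G" if "l \<in> lists (UNIV \<times> G)" for l
      using that by induction (auto simp: ev_def intro: span_zero span_add span_scale span_base)
    then show ?thesis by (auto simp: D_def)
  qed
  have D0: "0 \<in> D"
    unfolding D_def by (rule image_eqI[of _ _ "[]"]) (auto simp: ev_def)
  have D_add: "x + y \<in> D" if "x \<in> D" "y \<in> D" for x y
  proof -
    obtain l m where "x = ev l" "l \<in> lists (UNIV \<times> G)" "y = ev m" "m \<in> lists (UNIV \<times> G)"
      using \<open>x \<in> D\<close> \<open>y \<in> D\<close> by (auto simp: D_def)
    then show ?thesis
      unfolding D_def by (intro image_eqI[of _ _ "l @ m"]) (auto simp: ev_def)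
  qed
  have cl_add: "x + y \<in> closure D" if xy: "x \<in> closure D" "y \<in> closure D" for x y
  proof -
    obtain a b where "\<And>n. a n \<in> D" "a \<longlonglongrightarrow> x" "\<And>n. b n \<in> D" "b \<longlonglongrightarrow> y"
      using xy by (auto simp: closure_sequential)
    then show ?thesis
      unfolding closure_sequential
      by (intro exI[of _ "\<lambda>n. a n + b n"]) (auto intro: tendsto_add D_add)
  qed
  have cl_gen: "c *\<^sub>R g \<in> closure D" if "g \<in> G" for c g
  proof -
    have "of_rat q *\<^sub>R g \<in> D" for q
      unfolding D_def using that by (intro image_eqI[of _ _ "[(q, g)]"]) (auto simp: ev_def)
    moreover have "\<exists>q. c < real_of_rat q \<and> real_of_rat q < c + inverse (real (Suc n))" for n
      by (rule of_rat_dense) simp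
    then obtain q where q: "\<And>n. c < real_of_rat (q n)" "\<And>n. real_of_rat (q n) < c + inverse (real (Suc n))"
      by metis
    have "(\<lambda>n. real_of_rat (q n)) \<longlonglongrightarrow> c"
    proof (rule tendsto_sandwich[where f = "\<lambda>n. c" and h = "\<lambda>n. c + inverse (real (Suc n))"])
      show "(\<lambda>n. c + inverse (real (Suc n))) \<longlonglongrightarrow> c"
        by (rule LIMSEQ_inverse_real_of_nat_add)
    qed (simp_all add: less_imp_le q del: of_nat_Suc)
    then have "(\<lambda>n. real_of_rat (q n) *\<^sub>R g) \<longlonglongrightarrow> c *\<^sub>R g"
      by (intro tendsto_intros)
    ultimately show ?thesis
      unfolding closure_sequential by (intro exI[of _ "\<lambda>n. real_of_rat (q n) *\<^sub>R g"]) auto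
  qed
  have "x \<in> closure D" if "x \<in> span G" for x
    using that
  proof (induction rule: span_induct_alt)
    case base
    then show ?case using D0 closure_subset by blast
  next
    case (step c g x)
    then show ?case by (intro cl_add cl_gen)
  qed
  then have "closure D = closure (span G)"
    using D_span by (intro antisym closure_minimal closure_mono) auto
  then show thesis
    using that cD by blast
qed

section \<open>Uniform boundedness and weak-star convergence\<close>

text \<open>The closed sets \<open>E k\<close> cover the space, so by Baire's theorem one of them
  contains a ball. Differences of two points of this ball yield a bound near the origin, hence on
  the operator norms.\<close>

theorem uniform_boundedness:
  fixes f :: "nat \<Rightarrow> 'a::banach \<Rightarrow>\<^sub>L 'b::real_normed_vector"
  assumes bdd: "\<And>v. bounded (range (\<lambda>n. f n v))"
  obtains M where "M > 0" "\<And>n. norm (f n) \<le> M"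
proof -
  define E where "E = (\<lambda>k::nat. {v. \<forall>n. norm (f n v) \<le> real k})"
  have E_closed: "closed (E k)" for k
    unfolding E_def by (intro closed_Collect_all closed_Collect_le continuous_intros)
  have cover: "(\<Union>k. E k) = UNIV"
  proof -
    have "\<exists>k. v \<in> E k" for v
    proof -
      obtain B where "\<And>n. norm (f n v) \<le> B"
        using bdd[of v] by (auto simp: bounded_iff)
      then show ?thesis
        using real_arch_simple[of B] by (auto simp: E_def intro: order_trans)
    qed
    then show ?thesis by auto
  qed
  have "\<exists>k. interior (E k) \<noteq> {}"
  proof (rule ccontr)
    assume "\<not> ?thesis"
    then have "euclidean interior_of \<Union>(range E) = {}"
      using E_closed
      by (intro Baire_category_alt) (auto simp: completely_metrizable_space_euclidean)
    then show False by (simp add: cover)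
  qed
  then obtain k x0 where "x0 \<in> interior (E k)" by blast
  then obtain e where e: "e > 0" "cball x0 e \<subseteq> E k"
    by (auto simp: mem_interior_cball)
  have bnd: "norm (f n (x0 + w)) \<le> k" if "norm w \<le> e" for n w
  proof -
    have "x0 + w \<in> cball x0 e" using that by (simp add: dist_norm)
    then show ?thesis using e(2) by (auto simp: E_def)
  qed
  have le: "norm (f n) \<le> 2 * real k / e" for n
  proof (rule norm_blinfun_bound)
    show "0 \<le> 2 * real k / e" using e(1) by simp
    fix v
    show "norm (f n v) \<le> 2 * real k / e * norm v"
    proof (cases "v = 0")
      case False
      define w where "w = (e / norm v) *\<^sub>R v"
      have "f n w = f n (x0 + w) - f n (x0 + 0)"
        by (simp add: blinfun.add_right)
      also have "norm \<dots> \<le> real k + real k"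
        using e(1) False by (intro order_trans[OF norm_triangle_ineq4] add_mono bnd) (auto simp: w_def)
      finally have "norm (f n w) \<le> 2 * k" by simp
      moreover have "norm (f n w) = e / norm v * norm (f n v)"
        using e(1) by (simp add: w_def blinfun.scaleR_right)
      ultimately show ?thesis
        using e(1) False by (simp add: field_simps)
    qed simp
  qed
  show thesis
  proof
    \<comment> \<open>The summand 1 keeps the bound strictly positive even for
      \<open>k = 0\<close>.\<close>
    show "2 * real k / e + 1 > 0" using e(1) by (simp add: add_nonneg_pos)
    show "norm (f n) \<le> 2 * real k / e + 1" for n using le[of n] by simp
  qed
qed

section \<open>Weak-star limits and the pairing along convergent sequences\<close>

lemma weak_star_limD: "weak_star_lim f l F \<Longrightarrow> ((\<lambda>i. \<langle>v, f i\<rangle>) \<longlongrightarrow> \<langle>v, l\<rangle>) F"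
  by (simp add: weak_star_lim_iff)

lemma weak_star_lim_norm: "(f \<longlongrightarrow> l) F \<Longrightarrow> weak_star_lim f l F"
  by (auto simp: weak_star_lim_iff intro: tendsto_intros)

lemma weak_star_lim_unique:
  assumes "weak_star_lim f l F" "weak_star_lim f l' F" "F \<noteq> bot"
  shows "l = l'"
  using assms by (intro blinfun_eqI) (meson tendsto_unique weak_star_limD)

lemma weak_star_lim_bounded:
  fixes f :: "nat \<Rightarrow> 'y::banach \<Rightarrow>\<^sub>L real"
  assumes "weak_star_lim f l sequentially"
  obtains M where "M > 0" "\<And>n. norm (f n) \<le> M"
  by (rule uniform_boundedness[OF convergent_imp_bounded[OF weak_star_limD[OF assms]]]) (rule that)

text \<open>Norm convergence in \<open>Y\<close> against weak-star convergence in \<open>X\<close>: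
  the error \<open>g n - c\<close> is paired with a sequence that is bounded by the uniform
  boundedness principle.\<close>

lemma tendsto_pairing:
  fixes g :: "nat \<Rightarrow> 'y::banach"
  assumes g: "g \<longlonglongrightarrow> c" and f: "weak_star_lim f l sequentially"
  shows "(\<lambda>n. \<langle>g n, f n\<rangle>) \<longlonglongrightarrow> \<langle>c, l\<rangle>"
proof -
  obtain M where M: "\<And>n. norm (f n) \<le> M"
    by (rule weak_star_lim_bounded[OF f]) (rule that)
  have "(\<lambda>n. \<langle>g n - c, f n\<rangle>) \<longlonglongrightarrow> 0"
  proof (rule Lim_null_comparison)
    show "\<forall>\<^sub>F n in sequentially. norm \<langle>g n - c, f n\<rangle> \<le> M * norm (g n - c)"
      by (intro always_eventually allI order_trans[OF norm_blinfun] mult_right_mono M) simp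
    show "(\<lambda>n. M * norm (g n - c)) \<longlonglongrightarrow> 0"
      using g by (auto intro!: tendsto_mult_right_zero tendsto_norm_zero simp: LIM_zero)
  qed
  from tendsto_add[OF this weak_star_limD[OF f, of c]] show ?thesis
    by (simp add: blinfun.diff_right)
qed

text \<open>The complementary combination, weak convergence in \<open>Y\<close> against norm
  convergence in \<open>X\<close>; it is the one that strong recovery sequences call for.\<close>

lemma tendsto_pairing_weak:
  fixes g :: "nat \<Rightarrow> 'y::banach"
  assumes g: "weak_lim g c sequentially" and M: "\<And>n. norm (g n) \<le> M" and f: "f \<longlonglongrightarrow> l"
  shows "(\<lambda>n. \<langle>g n, f n\<rangle>) \<longlonglongrightarrow> \<langle>c, l\<rangle>"
proof -
  have "(\<lambda>n. \<langle>g n, f n - l\<rangle>) \<longlonglongrightarrow> 0"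
  proof (rule Lim_null_comparison)
    show "\<forall>\<^sub>F n in sequentially. norm \<langle>g n, f n - l\<rangle> \<le> norm (f n - l) * M"
      by (intro always_eventually allI order_trans[OF norm_blinfun] mult_left_mono M) simp
    show "(\<lambda>n. norm (f n - l) * M) \<longlonglongrightarrow> 0"
      using f by (auto intro!: tendsto_mult_left_zero tendsto_norm_zero simp: LIM_zero)
  qed
  moreover have "(\<lambda>n. \<langle>g n, l\<rangle>) \<longlonglongrightarrow> \<langle>c, l\<rangle>"
    using g by (simp add: weak_lim_def)
  ultimately show ?thesis
    using tendsto_add by (fastforce simp: blinfun.diff_left)
qed

section \<open>Weak-star sequential compactness\<close>

lemma convergent_subseq_countable:
  fixes f :: "nat \<Rightarrow> 'a \<Rightarrow> real"
  assumes D: "countable D" and bdd: "\<And>d. d \<in> D \<Longrightarrow> bounded (range (\<lambda>n. f n d))"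
  obtains s where "strict_mono (s :: nat \<Rightarrow> nat)" "\<And>d. d \<in> D \<Longrightarrow> convergent (\<lambda>n. f (s n) d)"
proof (cases "D = {}")
  case True
  then show thesis using that[of id] by (simp add: strict_mono_def)
next
  case False
  define e where "e = from_nat_into D"
  have e: "range e = D"
    unfolding e_def using D False by (rule range_from_nat_into[rotated])
  interpret subseqs "\<lambda>k s. convergent (\<lambda>n. f (s n) (e k))"
  proof
    fix k and s :: "nat \<Rightarrow> nat"
    have "e k \<in> D" using e by blast
    then have "bounded (range (\<lambda>n. f (s n) (e k)))"
      by (rule bounded_subset[OF bdd]) auto
    then obtain l r where "strict_mono (r :: nat \<Rightarrow> nat)" "((\<lambda>n. f (s n) (e k)) \<circ> r) \<longlonglongrightarrow> l"
      using bounded_imp_convergent_subsequence by blast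
    then show "\<exists>r. strict_mono r \<and> convergent (\<lambda>n. f ((s \<circ> r) n) (e k))"
      by (auto simp: o_def convergent_def)
  qed
  show thesis
  proof
    show "strict_mono diagseq" by (rule subseq_diagseq)
    fix d assume "d \<in> D"
    then obtain k where k: "d = e k" using e by blast
    \<comment> \<open>The diagonal sequence is a subsequence of the \<open>k\<close>-th selected one
      only from index \<open>Suc k\<close> on; the finitely many earlier terms do not affect
      convergence.\<close>
    have "convergent (\<lambda>n. f ((diagseq \<circ> (+) (Suc k)) n) (e k))"
      by (rule diagseq_holds) (auto dest: convergent_subseq_convergent simp: o_def)
    then have "convergent (\<lambda>n. f (diagseq (n + Suc k)) d)"
      by (simp add: k add.commute)
    then show "convergent (\<lambda>n. f (diagseq n) d)"
      by (subst (asm) convergent_ignore_initial_segment[where f = "\<lambda>n. f (diagseq n) d"])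
  qed
qed

text \<open>Linearity extends convergence from \<open>G\<close> to its span. The common norm bound
  makes the functionals equicontinuous, so an epsilon-third argument reaches the closure, and the
  same bound makes the pointwise limit a bounded functional.\<close>

lemma weak_star_limit_exists:
  fixes x :: "nat \<Rightarrow> 'y::real_normed_vector \<Rightarrow>\<^sub>L real"
  assumes M: "\<And>n. norm (x n) \<le> M"
    and G: "\<And>v. v \<in> G \<Longrightarrow> convergent (\<lambda>n. x n v)"
    and dense: "closure (span G) = UNIV"
  obtains l where "weak_star_lim x l sequentially"
proof -
  have M0: "M \<ge> 0" using M[of 0] norm_ge_zero order_trans by blast
  have bnd: "norm (x n v) \<le> M * norm v" for n v
    by (rule order_trans[OF norm_blinfun mult_right_mono[OF M]]) simp
  have span: "convergent (\<lambda>n. x n v)" if "v \<in> span G" for v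
    using that
  proof (induction rule: span_induct_alt)
    case base
    then show ?case by (simp add: convergent_const)
  next
    case (step c g w)
    then have "convergent (\<lambda>n. c * x n g + x n w)"
      by (intro convergent_add convergent_mult convergent_const) (auto intro: G)
    then show ?case by (simp add: blinfun.add_right blinfun.scaleR_right)
  qed
  have conv: "convergent (\<lambda>n. x n v)" for v
  proof -
    have "Cauchy (\<lambda>n. x n v)"
    proof (rule CauchyI)
      fix e :: real assume e: "e > 0"
      \<comment> \<open>The denominator uses \<open>M + 1\<close> because \<open>M\<close> may be
        zero.\<close>
      have "v \<in> closure (span G)" "e / (3 * (M + 1)) > 0"
        using dense M0 e by simp_all
      then obtain w where w: "w \<in> span G" "dist w v < e / (3 * (M + 1))"
        unfolding closure_approachable by blast
      have small: "norm (x n v - x n w) < e / 3" for n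
      proof -
        have "norm (x n v - x n w) \<le> M * norm (v - w)"
          using bnd[of n "v - w"] by (simp add: blinfun.diff_right)
        also have "\<dots> \<le> (M + 1) * norm (v - w)"
          by (intro mult_right_mono) auto
        also have "\<dots> < e / 3"
          using w(2) M0 by (simp add: dist_norm norm_minus_commute field_simps)
        finally show ?thesis .
      qed
      obtain N where N: "\<And>m n. m \<ge> N \<Longrightarrow> n \<ge> N \<Longrightarrow> norm (x m w - x n w) < e / 3"
        using CauchyD[OF convergent_Cauchy[OF span[OF w(1)]], of "e / 3"] e by auto
      have "norm (x m v - x n v) < e" if "m \<ge> N" "n \<ge> N" for m n
        using small[of m] small[of n] N[OF that] by (simp add: abs_if split: if_splits)
      then show "\<exists>N. \<forall>m\<ge>N. \<forall>n\<ge>N. norm (x m v - x n v) < e" by blast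
    qed
    then show ?thesis by (rule Cauchy_convergent)
  qed
  define l where "l = (\<lambda>v. lim (\<lambda>n. x n v))"
  have lim: "(\<lambda>n. x n v) \<longlonglongrightarrow> l v" for v
    using conv[of v] by (simp add: l_def convergent_LIMSEQ_iff)
  have "bounded_linear l"
  proof (rule bounded_linear_intro)
    show "l (v + w) = l v + l w" for v w
      using lim[of "v + w"] tendsto_add[OF lim[of v] lim[of w]]
      by (simp add: blinfun.add_right LIMSEQ_unique)
    show "l (c *\<^sub>R v) = c *\<^sub>R l v" for c v
      using lim[of "c *\<^sub>R v"] tendsto_scaleR[OF tendsto_const lim[of v], of c]
      by (simp add: blinfun.scaleR_right LIMSEQ_unique)
    show "norm (l v) \<le> norm v * M" for v
      using tendsto_norm[OF lim[of v]] bnd[of _ v]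
      by (intro LIMSEQ_le_const2[where X = "\<lambda>n. norm (x n v)"]) (auto simp: mult.commute)
  qed
  then have "weak_star_lim x (Blinfun l) sequentially"
    using lim by (simp add: weak_star_lim_iff bounded_linear_Blinfun_apply)
  then show thesis by (rule that)
qed

text \<open>
  In a reflexive space \<open>Y\<close> a bounded sequence of functionals \<open>x n\<close> with common kernel \<open>N\<close> lives on
  \<open>Y / N\<close>, whose dual, the closed span of the sequence, is separable; hence \<open>Y / N\<close> is separable.
\<close>

lemma countable_spanning_modulo_kernel:
  fixes x :: "nat \<Rightarrow> 'y::real_normed_vector \<Rightarrow>\<^sub>L real"
  assumes refl: "reflexive_space TYPE('y)"
  obtains D where "countable D" "closure (span (D \<union> {v. \<forall>n. x n v = 0})) = UNIV"
proof -
  define N where "N = {v. \<forall>n. x n v = 0}"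
  obtain Z where Z: "countable Z" "closure Z = closure (span (range x))"
    using closure_span_countable_dense[of "range x"] by auto
  \<comment> \<open>The norm of a functional need not be visibly attained, so a vector of the unit
    ball is chosen that realises at least half of it.\<close>
  have "\<exists>v. norm v \<le> 1 \<and> norm z \<le> 2 * \<langle>v, z\<rangle>" for z :: "'y \<Rightarrow>\<^sub>L real"
  proof (cases "z = 0")
    case False
    have "\<exists>w. norm (z w) > norm z / 2 * norm w"
    proof (rule ccontr)
      assume "\<not> ?thesis"
      then have "norm z \<le> norm z / 2"
        by (intro norm_blinfun_bound) (auto simp: not_less)
      then show False using False by simp
    qed
    then obtain w where w: "norm (z w) > norm z / 2 * norm w" by blast
    then have w0: "w \<noteq> 0" by auto
    define v where "v = (sgn (z w) / norm w) *\<^sub>R w"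
    have "\<langle>v, z\<rangle> = norm (z w) / norm w"
      by (simp add: v_def blinfun.scaleR_right abs_sgn)
    moreover have "norm z \<le> 2 * (norm (z w) / norm w)"
      using w w0 by (simp add: field_simps)
    moreover have "norm v \<le> 1"
      using w0 by (simp add: v_def sgn_if)
    ultimately show ?thesis by (intro exI[of _ v]) simp
  qed (auto intro: exI[of _ 0])
  then obtain V where V: "\<And>z :: 'y \<Rightarrow>\<^sub>L real. norm (V z) \<le> 1" "\<And>z. norm z \<le> 2 * \<langle>V z, z\<rangle>"
    by metis
  define W where "W = closure (span (V ` Z \<union> N))"
  have "W = UNIV"
  proof (rule ccontr)
    assume "W \<noteq> UNIV"
    then obtain v where v: "v \<notin> W" by blast
    have "subspace W" "closed W"
      unfolding W_def by (auto intro: subspace_closure)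
    then obtain f :: "'y \<Rightarrow>\<^sub>L real" where f: "\<And>w. w \<in> W \<Longrightarrow> f w = 0" "f v \<noteq> 0"
      using Hahn_Banach_separation[OF _ _ v] by blast
    have W_gen: "w \<in> W" if "w \<in> V ` Z \<union> N" for w
      unfolding W_def by (rule subsetD[OF closure_subset span_base[OF that]])
    \<comment> \<open>Here reflexivity enters: a separating functional on the dual is evaluation at
      some \<open>u\<close>. As it annihilates every \<open>x n\<close>, this \<open>u\<close> lies
      in \<open>N\<close>, where \<open>f\<close> vanishes, contradicting the separation.\<close>
    have "f \<in> closure (span (range x))"
    proof (rule ccontr)
      assume "f \<notin> closure (span (range x))"
      then obtain \<phi> :: "('y \<Rightarrow>\<^sub>L real) \<Rightarrow>\<^sub>L real"
        where \<phi>: "\<And>g. g \<in> closure (span (range x)) \<Longrightarrow> \<phi> g = 0" "\<phi> f \<noteq> 0"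
        using Hahn_Banach_separation[OF subspace_closure[OF subspace_span] closed_closure] by blast
      obtain u where u: "\<And>g. \<phi> g = \<langle>u, g\<rangle>"
        using refl by (auto simp: reflexive_space_def)
      have "x n \<in> closure (span (range x))" for n
        by (rule subsetD[OF closure_subset span_base[OF rangeI]])
      then have "u \<in> N"
        using \<phi>(1) u by (simp add: N_def)
      then show False
        using \<phi>(2) u f(1)[OF W_gen] by simp
    qed
    then have fZ: "f \<in> closure Z" by (simp add: Z)
    \<comment> \<open>Since \<open>f\<close> vanishes at \<open>V z\<close>, the choice of
      \<open>V\<close> gives \<open>norm z \<le> 2 * norm (z - f)\<close>, hence
      \<open>norm f \<le> 3 * norm (z - f)\<close>; this is why \<open>z\<close> is taken within
      \<open>e / 3\<close> of \<open>f\<close>.\<close>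
    have "norm f \<le> 0 + e" if e: "e > 0" for e
    proof -
      obtain z where z: "z \<in> Z" "dist z f < e / 3"
        using fZ e unfolding closure_approachable by (meson divide_pos_pos zero_less_numeral)
      have "f (V z) = 0"
        using z(1) by (intro f(1) W_gen) simp
      then have "norm z \<le> 2 * \<langle>V z, z - f\<rangle>"
        using V(2)[of z] by (simp add: blinfun.diff_left)
      also have "\<langle>V z, z - f\<rangle> \<le> norm (z - f) * norm (V z)"
        using norm_blinfun[of "z - f" "V z"] by simp
      also have "\<dots> \<le> norm (z - f) * 1"
        by (intro mult_left_mono V) simp
      finally have "norm z \<le> 2 * norm (z - f)" by simp
      moreover have "norm f \<le> norm z + norm (z - f)"
        using norm_triangle_ineq[of z "f - z"] by (simp add: norm_minus_commute)
      ultimately show ?thesis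
        using z(2) by (simp add: dist_norm)
    qed
    then have "norm f \<le> 0" by (rule field_le_epsilon)
    then show False using f(2) by simp
  qed
  then show thesis
    using that[of "V ` Z"] Z(1) by (simp add: W_def N_def)
qed

text \<open>On the common kernel \<open>N\<close> the sequence is constantly zero, so the diagonal
  argument only has to treat a countable \<open>D\<close> that spans a dense subspace together with
  \<open>N\<close>. This covers the separable and the reflexive case at once.\<close>

theorem weak_star_sequentially_compact:
  fixes x :: "nat \<Rightarrow> 'y::banach \<Rightarrow>\<^sub>L real"
  assumes Y: "reflexive_space TYPE('y) \<or> separable_space (euclidean :: 'y topology)"
    and M: "\<And>n. norm (x n) \<le> M"
  obtains l s where "strict_mono (s :: nat \<Rightarrow> nat)" "weak_star_lim (\<lambda>n. x (s n)) l sequentially"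
proof -
  define N where "N = {v. \<forall>n. x n v = 0}"
  have "\<exists>D. countable D \<and> closure (span (D \<union> N)) = UNIV"
    using Y
  proof
    assume "reflexive_space TYPE('y)"
    then show ?thesis
      unfolding N_def by (rule countable_spanning_modulo_kernel[of x]) blast
  next
    assume "separable_space (euclidean :: 'y topology)"
    then obtain D :: "'y set" where D: "countable D" "closure D = UNIV"
      by (auto simp: separable_space_def)
    have "closure D \<subseteq> closure (span (D \<union> N))"
      by (intro closure_mono) (auto intro: span_base)
    then show ?thesis using D by auto
  qed
  then obtain D where D: "countable D" "closure (span (D \<union> N)) = UNIV" by blast
  have "bounded (range (\<lambda>n. x n d))" for d
    unfolding bounded_iff
    by (intro exI[of _ "M * norm d"])
      (auto intro: order_trans[OF norm_blinfun mult_right_mono[OF M]] simp del: real_norm_def)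
  then obtain s where s: "strict_mono s" "\<And>d. d \<in> D \<Longrightarrow> convergent (\<lambda>n. x (s n) d)"
    by (rule convergent_subseq_countable[OF D(1), of "\<lambda>n. blinfun_apply (x n)"]) (rule that)
  have "convergent (\<lambda>n. x (s n) v)" if "v \<in> D \<union> N" for v
    using that s(2) by (auto simp: N_def convergent_const)
  then obtain l where "weak_star_lim (\<lambda>n. x (s n)) l sequentially"
    by (rule weak_star_limit_exists[of "\<lambda>n. x (s n)", OF M _ D(2)])
  then show thesis using s(1) that by blast
qed

section \<open>Limits of variational inequalities\<close>

text \<open>Norm convergence of \<open>B (ys n)\<close> makes the quadratic form actually converge
  along \<open>ys\<close>, so its lower limit is the value at \<open>y\<close>.\<close>

lemma completely_continuous_imp_weak_star_weak_continuous_lsc: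
  fixes B :: "('y::banach \<Rightarrow>\<^sub>L real) \<Rightarrow>\<^sub>L 'y"
  assumes "weak_star_completely_continuous B"
  shows "weak_star_weak_continuous_lsc B"
  unfolding weak_star_weak_continuous_lsc_def
proof (intro allI impI conjI)
  fix ys :: "nat \<Rightarrow> 'y \<Rightarrow>\<^sub>L real" and y
  assume ys: "weak_star_lim ys y sequentially"
  then have B: "(\<lambda>n. B (ys n)) \<longlonglongrightarrow> B y"
    using assms by (simp add: weak_star_completely_continuous_def)
  then show "weak_lim (\<lambda>n. B (ys n)) (B y) sequentially"
    by (auto simp: weak_lim_def intro: tendsto_intros)
  have "(\<lambda>n. ereal \<langle>B (ys n), ys n\<rangle>) \<longlonglongrightarrow> ereal \<langle>B y, y\<rangle>"
    using tendsto_pairing[OF B ys] by simp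
  from lim_imp_Liminf[OF sequentially_bot this]
  show "ereal \<langle>B y, y\<rangle> \<le> liminf (\<lambda>n. ereal \<langle>B (ys n), ys n\<rangle>)" by simp
qed

section \<open>Second-order quotients and the second subderivative\<close>

lemma VI_second_quot:
  assumes j: "proper_fun j" and x0: "x0 \<in> edom j"
    and xt: "x0 + t *\<^sub>R y \<in> VI_solutions j A p" and t: "t > 0"
    and Ap: "A p (x0 + t *\<^sub>R y) = t *\<^sub>R w - g"
  shows "ereal \<langle>w, y\<rangle> + ereal (1/2) * second_quot j x0 g t y
    \<le> ereal \<langle>w, z\<rangle> + ereal (1/2) * second_quot j x0 g t z"
proof -
  obtain a where a: "j x0 = ereal a"
    using x0 by (auto simp: edom_def)
  obtain b where b: "j (x0 + t *\<^sub>R y) = ereal b"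
    using xt by (auto simp: VI_solutions_def edom_def)
  \<comment> \<open>The test point \<open>x0 + t *\<^sub>R z\<close> differs from the solution by
    \<open>t *\<^sub>R (z - y)\<close>. The contribution of \<open>- g\<close> supplies the linear
    terms of the two quotients, and \<open>t *\<^sub>R w\<close> is of second order in
    \<open>t\<close>.\<close>
  have VI: "ereal \<langle>t *\<^sub>R w - g, t *\<^sub>R (z - y)\<rangle> + j (x0 + t *\<^sub>R z) - ereal b \<ge> 0"
    using xt unfolding VI_solutions_def
    by (auto simp: Ap b scaleR_diff_right dest!: spec[of _ "x0 + t *\<^sub>R z"])
  show ?thesis
  proof (cases "j (x0 + t *\<^sub>R z)")
    case (real c)
    have "t * \<langle>t *\<^sub>R w - g, z - y\<rangle> + c - b \<ge> 0"
      using VI by (simp add: real blinfun.scaleR_left)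
    then have "t\<^sup>2 * \<langle>w, y\<rangle> + (b - a - t * \<langle>g, y\<rangle>) \<le> t\<^sup>2 * \<langle>w, z\<rangle> + (c - a - t * \<langle>g, z\<rangle>)"
      by (simp add: blinfun.diff_left blinfun.diff_right blinfun.scaleR_right
          algebra_simps power2_eq_square)
    then have "\<langle>w, y\<rangle> + (b - a - t * \<langle>g, y\<rangle>) / t\<^sup>2 \<le> \<langle>w, z\<rangle> + (c - a - t * \<langle>g, z\<rangle>) / t\<^sup>2"
      using t by (simp add: divide_simps mult.commute)
    moreover have "ereal (1/2) * (ereal d / ereal (t\<^sup>2 / 2)) = ereal (d / t\<^sup>2)" for d
      using t by simp
    ultimately show ?thesis
      by (simp only: second_quot_def a b real ereal_minus plus_ereal.simps ereal_less_eq)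
  next
    case PInf
    then have "second_quot j x0 g t z = \<infinity>"
      using t by (simp add: second_quot_def a)
    then show ?thesis by simp
  next
    case MInf
    then show ?thesis using j by (auto simp: proper_fun_def)
  qed
qed

lemma second_quot_0: "x0 \<in> edom j \<Longrightarrow> second_quot j x0 g t 0 = 0"
  by (auto simp: second_quot_def edom_def)

text \<open>This is the rescaled inequality for the unperturbed solution, with \<open>y = 0\<close>
  and \<open>w = 0\<close>.\<close>

lemma second_quot_nonneg:
  assumes "proper_fun j" "x0 \<in> VI_solutions j A p" "A p x0 = - g" "t > 0"
  shows "0 \<le> second_quot j x0 g t z"
proof -
  have x0: "x0 \<in> edom j" using assms(2) by (simp add: VI_solutions_def)
  have "0 \<le> ereal (1/2) * second_quot j x0 g t z"
    using VI_second_quot[OF assms(1) x0, of t 0 A p 0 g z] assms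
    by (simp add: second_quot_0 x0 zero_ereal_def)
  then show ?thesis
    by (simp add: ereal_zero_le_0_iff)
qed

lemma second_subderiv_le:
  assumes "pos_null_seq t" "weak_star_lim zs z sequentially"
  shows "second_subderiv j x g z \<le> liminf (\<lambda>n. second_quot j x g (t n) (zs n))"
  unfolding second_subderiv_def using assms by (intro Inf_lower) blast

lemma second_subderiv_nonneg:
  assumes "proper_fun j" "x0 \<in> VI_solutions j A p" "A p x0 = - g"
  shows "0 \<le> second_subderiv j x0 g z"
  unfolding second_subderiv_def
  using second_quot_nonneg[OF assms]
  by (intro Inf_greatest) (auto simp: pos_null_seq_def intro!: Liminf_bounded always_eventually)

text \<open>The double successor keeps all terms at most \<open>t0 / 2\<close>, hence strictly
  inside the parameter interval.\<close>

lemma pos_null_seq_inverse: "t0 > 0 \<Longrightarrow> pos_null_seq (\<lambda>n. t0 * inverse (real (Suc (Suc n))))"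
  unfolding pos_null_seq_def
  using LIMSEQ_Suc[OF LIMSEQ_inverse_real_of_nat] by (auto intro: tendsto_mult_right_zero)

lemma second_subderiv_0_le:
  assumes "x0 \<in> edom j"
  shows "second_subderiv j x0 g 0 \<le> 0"
proof -
  have "second_subderiv j x0 g 0 \<le> liminf (\<lambda>n. second_quot j x0 g (1 * inverse (real (Suc (Suc n)))) 0)"
    by (intro second_subderiv_le pos_null_seq_inverse) (auto simp: weak_star_lim_iff)
  then show ?thesis
    by (simp add: second_quot_0[OF assms] Liminf_const)
qed

text \<open>The passage to the limit is separated from \<open>j\<close>: of the functionals
  \<open>q n\<close> it uses only the lower bound along \<open>ys\<close> and the recovery
  sequences. These are the two halves of epi-convergence.\<close>

lemma linearised_VI_limit:
  fixes B :: "('y::banach \<Rightarrow>\<^sub>L real) \<Rightarrow>\<^sub>L 'y"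
    and q :: "nat \<Rightarrow> ('y \<Rightarrow>\<^sub>L real) \<Rightarrow> ereal"
  assumes VI: "\<And>n z. ereal \<langle>b n + B (ys n), ys n\<rangle> + ereal (1/2) * q n (ys n)
      \<le> ereal \<langle>b n + B (ys n), z\<rangle> + ereal (1/2) * q n z"
    and b: "b \<longlonglongrightarrow> c" and ys: "weak_star_lim ys y sequentially"
    and B: "ereal \<langle>B y, y\<rangle> \<le> liminf (\<lambda>n. ereal \<langle>B (ys n), ys n\<rangle>)"
    and Q: "\<And>z. 0 \<le> Q z" "Q 0 \<le> 0" "Q y \<le> liminf (\<lambda>n. q n (ys n))"
    and recovery: "\<And>z. \<exists>zs. weak_star_lim zs z sequentially \<and>
      (\<lambda>n. \<langle>B (ys n), zs n\<rangle>) \<longlonglongrightarrow> \<langle>B y, z\<rangle> \<and> (\<lambda>n. q n (zs n)) \<longlonglongrightarrow> Q z"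
  shows "linearised_VI_solution c B Q y" "(\<lambda>n. \<langle>B (ys n), ys n\<rangle>) \<longlonglongrightarrow> \<langle>B y, y\<rangle>"
proof -
  define s where "s = (\<lambda>n. \<langle>B (ys n), ys n\<rangle>)"
  \<comment> \<open>The pairings of \<open>b n\<close> with \<open>ys n\<close> converge, so they
    are moved to the right-hand side. What remains on the left is the quadratic form plus half of
    \<open>q n (ys n)\<close>, dominated by a convergent sequence.\<close>
  have key: "\<exists>e. e \<longlonglongrightarrow> ereal (\<langle>c + B y, z\<rangle> - \<langle>c, y\<rangle>) + ereal (1/2) * Q z \<and>
    (\<forall>n. ereal (s n) + ereal (1/2) * q n (ys n) \<le> e n)" for z
  proof -
    obtain zs where zs: "weak_star_lim zs z sequentially"
      "(\<lambda>n. \<langle>B (ys n), zs n\<rangle>) \<longlonglongrightarrow> \<langle>B y, z\<rangle>" "(\<lambda>n. q n (zs n)) \<longlonglongrightarrow> Q z"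
      using recovery by blast
    define d where "d = (\<lambda>n. \<langle>b n, zs n\<rangle> + \<langle>B (ys n), zs n\<rangle> - \<langle>b n, ys n\<rangle>)"
    have "d \<longlonglongrightarrow> \<langle>c + B y, z\<rangle> - \<langle>c, y\<rangle>"
      unfolding d_def blinfun.add_right
      by (intro tendsto_diff tendsto_add tendsto_pairing b zs ys)
    then have "(\<lambda>n. ereal (d n)) \<longlonglongrightarrow> ereal (\<langle>c + B y, z\<rangle> - \<langle>c, y\<rangle>)"
      by simp
    moreover have "(\<lambda>n. ereal (1/2) * q n (zs n)) \<longlonglongrightarrow> ereal (1/2) * Q z"
      using zs(3) by (intro tendsto_cmult_ereal) auto
    ultimately have "(\<lambda>n. ereal (d n) + ereal (1/2) * q n (zs n))
        \<longlonglongrightarrow> ereal (\<langle>c + B y, z\<rangle> - \<langle>c, y\<rangle>) + ereal (1/2) * Q z"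
      using Q(1)[of z] by (intro tendsto_add_ereal_general) auto
    moreover have "ereal (s n) + ereal (1/2) * q n (ys n) \<le> ereal (d n) + ereal (1/2) * q n (zs n)" for n
      using VI[of n "zs n"]
      by (cases "q n (ys n)"; cases "q n (zs n)") (auto simp: s_def d_def blinfun.add_right)
    ultimately show ?thesis by blast
  qed
  have liminf_half: "ereal (1/2) * Q y \<le> liminf (\<lambda>n. ereal (1/2) * q n (ys n))"
    using Q(3) by (subst Liminf_ereal_mult_left) (auto intro: ereal_mult_left_mono)
  have ineq: "ereal \<langle>B y, y\<rangle> + ereal (1/2) * Q y
      \<le> ereal (\<langle>c + B y, z\<rangle> - \<langle>c, y\<rangle>) + ereal (1/2) * Q z" for z
  proof -
    obtain e where e: "e \<longlonglongrightarrow> ereal (\<langle>c + B y, z\<rangle> - \<langle>c, y\<rangle>) + ereal (1/2) * Q z"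
      "\<And>n. ereal (s n) + ereal (1/2) * q n (ys n) \<le> e n"
      using key by blast
    \<comment> \<open>Together with the real lower bound on the other lower limit, this excludes a
      sum of opposite infinities when the two lower limits are added.\<close>
    have "0 \<le> liminf (\<lambda>n. ereal (1/2) * q n (ys n))"
      using Q(1)[of y] liminf_half by (auto intro: order_trans[rotated])
    then have "ereal \<langle>B y, y\<rangle> + ereal (1/2) * Q y
        \<le> liminf (\<lambda>n. ereal (s n)) + liminf (\<lambda>n. ereal (1/2) * q n (ys n))"
      using B liminf_half by (intro add_mono) (auto simp: s_def)
    also have "\<dots> \<le> liminf (\<lambda>n. ereal (s n) + ereal (1/2) * q n (ys n))"
      using B \<open>0 \<le> liminf (\<lambda>n. ereal (1/2) * q n (ys n))\<close>
      by (intro ereal_liminf_add_mono) (auto simp: s_def)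
    also have "\<dots> \<le> liminf e"
      using e(2) by (intro Liminf_mono always_eventually) auto
    also have "\<dots> = ereal (\<langle>c + B y, z\<rangle> - \<langle>c, y\<rangle>) + ereal (1/2) * Q z"
      using e(1) by (simp add: lim_imp_Liminf)
    finally show ?thesis .
  qed
  \<comment> \<open>For \<open>z = 0\<close> the right-hand side is a real number because
    \<open>Q 0 = 0\<close>.\<close>
  have Qy: "Q y < \<infinity>"
    using ineq[of 0] Q(2) Q(1)[of 0] by (cases "Q y") (auto simp: zero_ereal_def)
  then obtain k where k: "Q y = ereal k"
    using Q(1)[of y] by (cases "Q y") auto
  show "linearised_VI_solution c B Q y"
    unfolding linearised_VI_solution_def
  proof (intro conjI allI Qy)
    fix z
    show "0 \<le> ereal \<langle>c + B y, z - y\<rangle> + ereal (1/2) * Q z - ereal (1/2) * Q y"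
      using ineq[of z] Q(1)[of z]
      by (cases "Q z") (auto simp: k zero_ereal_def blinfun.add_right blinfun.diff_right
          blinfun.add_left blinfun.diff_left)
  qed
  have "s \<longlonglongrightarrow> \<langle>B y, y\<rangle>"
  proof (rule order_tendstoI)
    fix a assume "a < \<langle>B y, y\<rangle>"
    then have "ereal a < liminf (\<lambda>n. ereal (s n))"
      using B by (auto simp: s_def intro: less_le_trans[rotated])
    then show "\<forall>\<^sub>F n in sequentially. a < s n"
      by (auto dest: less_LiminfD)
  next
    fix a assume a: "\<langle>B y, y\<rangle> < a"
    \<comment> \<open>The gap \<open>a - \<langle>B y, y\<rangle>\<close> is split in two: one
      \<epsilon> is spent on the upper bound \<open>e n\<close>, the other on half of
      \<open>q n (ys n)\<close>, which is why \<open>q n (ys n)\<close> may fall below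
      \<open>k\<close> by up to \<open>2 * \<epsilon>\<close>.\<close>
    define \<epsilon> where "\<epsilon> = (a - \<langle>B y, y\<rangle>) / 2"
    have \<epsilon>: "\<epsilon> > 0" "a = \<langle>B y, y\<rangle> + 2 * \<epsilon>" using a by (simp_all add: \<epsilon>_def field_simps)
    obtain e where e: "e \<longlonglongrightarrow> ereal (\<langle>B y, y\<rangle> + k / 2)"
      "\<And>n. ereal (s n) + ereal (1/2) * q n (ys n) \<le> e n"
      using key[of y] by (auto simp: k blinfun.add_right)
    have "\<forall>\<^sub>F n in sequentially. e n < ereal (\<langle>B y, y\<rangle> + k / 2 + \<epsilon>)"
      using e(1) by (rule order_tendstoD) (use \<epsilon> in simp)
    moreover have "\<forall>\<^sub>F n in sequentially. ereal (k - 2 * \<epsilon>) < q n (ys n)"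
      using Q(3) \<epsilon> by (intro less_LiminfD) (auto simp: k intro: less_le_trans[rotated])
    ultimately show "\<forall>\<^sub>F n in sequentially. s n < a"
    proof eventually_elim
      case (elim n)
      then have "ereal (s n) + ereal (1/2) * q n (ys n) < ereal (\<langle>B y, y\<rangle> + k / 2 + \<epsilon>)"
        using e(2)[of n] by simp
      then show "s n < a"
        using elim(2) \<epsilon>(2) by (cases "q n (ys n)") auto
    qed
  qed
  then show "(\<lambda>n. \<langle>B (ys n), ys n\<rangle>) \<longlonglongrightarrow> \<langle>B y, y\<rangle>"
    by (simp add: s_def)
qed

text \<open>The subsequence principle: if the limit failed, some sequence would stay outside a
  neighbourhood of \<open>l\<close>, and so would all its subsequences. It turns compactness plus
  uniqueness of the limit into convergence of the whole family.\<close>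

lemma tendsto_at_right_subseqI:
  fixes f :: "real \<Rightarrow> 'a::topological_space"
  assumes t0: "t0 > 0"
    and sub: "\<And>t. pos_null_seq t \<Longrightarrow> (\<forall>n. t n < t0) \<Longrightarrow>
      \<exists>s. strict_mono (s :: nat \<Rightarrow> nat) \<and> (\<lambda>n. f (t (s n))) \<longlonglongrightarrow> l"
  shows "(f \<longlongrightarrow> l) (at_right 0)"
proof (rule tendsto_at_right_sequentially[OF t0])
  fix t :: "nat \<Rightarrow> real"
  assume t: "\<And>n. 0 < t n" "\<And>n. t n < t0" "t \<longlonglongrightarrow> 0"
  show "(\<lambda>n. f (t n)) \<longlonglongrightarrow> l"
  proof (rule topological_tendstoI, rule ccontr)
    fix U assume U: "open U" "l \<in> U" and "\<not> (\<forall>\<^sub>F n in sequentially. f (t n) \<in> U)"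
    then obtain r where r: "strict_mono (r :: nat \<Rightarrow> nat)" "\<And>n. f (t (r n)) \<notin> U"
      using not_eventually_sequentiallyD by blast
    have "pos_null_seq (t \<circ> r)"
      using t r(1) by (simp add: pos_null_seq_def LIMSEQ_subseq_LIMSEQ)
    then obtain s where "(\<lambda>n. f ((t \<circ> r) (s n))) \<longlonglongrightarrow> l"
      using sub t(2) by (metis comp_apply)
    then have "\<forall>\<^sub>F n in sequentially. f (t (r (s n))) \<in> U"
      using U by (auto dest: topological_tendstoD)
    then show False using r(2) by simp
  qed
qed

section \<open>Limits of the difference quotients of the solution family\<close>

theorem theorem2p13:
  fixes j :: "('y::banach) \<Rightarrow>\<^sub>L real \<Rightarrow> ereal"
    and A :: "'p::real_normed_vector \<Rightarrow> ('y \<Rightarrow>\<^sub>L real) \<Rightarrow> 'y"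
    and t0 L :: real
    and qt :: "real \<Rightarrow> 'p" and q :: 'p
    and xb y :: "real \<Rightarrow> ('y \<Rightarrow>\<^sub>L real)"
    and Ap :: "'p \<Rightarrow>\<^sub>L 'y" and Ax :: "('y \<Rightarrow>\<^sub>L real) \<Rightarrow>\<^sub>L 'y"
    and r :: "real \<Rightarrow> 'y" and a0 :: 'y
    and Q :: "('y \<Rightarrow>\<^sub>L real) \<Rightarrow> ereal"
  assumes Y: "reflexive_space TYPE('y) \<or> separable_space (euclidean :: 'y topology)"
    and j: "proper_fun j"
    and t0: "0 < t0"
    and q_lim: "(qt \<longlongrightarrow> q) (at_right 0)"
    and sol: "\<And>t. 0 < t \<Longrightarrow> t < t0 \<Longrightarrow> xb t \<in> VI_solutions j A (t *\<^sub>R qt t)"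
    and sol0: "xb 0 \<in> VI_solutions j A 0"
    and L: "0 < L"
    and Lip: "\<And>t. 0 \<le> t \<Longrightarrow> t < t0 \<Longrightarrow> norm (xb t - xb 0) \<le> L * t"
    and y: "y = (\<lambda>t. (1 / t) *\<^sub>R (xb t - xb 0))"
    and expansion: "\<And>t. 0 < t \<Longrightarrow> t < t0 \<Longrightarrow>
          A (t *\<^sub>R qt t) (xb 0 + t *\<^sub>R y t)
            = A 0 (xb 0) + t *\<^sub>R Ap (qt t) + t *\<^sub>R Ax (y t) + r t"
    and remainder: "((\<lambda>t. norm (r t) / t) \<longlongrightarrow> 0) (at_right 0)"
    and a0: "a0 = - A 0 (xb 0)"
    and Q: "Q = second_subderiv j (xb 0) a0"
    and cases: "(weak_star_twice_epi_diff j (xb 0) a0 \<and> weak_star_completely_continuous Ax) \<or>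
                (strong_twice_epi_diff j (xb 0) a0 \<and> weak_star_weak_continuous_lsc Ax)"
  shows "(\<exists>\<eta>. weak_star_acc_point t0 y \<eta>) \<and>
    (\<forall>\<eta>. weak_star_acc_point t0 y \<eta> \<longrightarrow>
       linearised_VI_solution (Ap q) Ax Q \<eta> \<and>
       (\<forall>t. pos_null_seq t \<longrightarrow> (\<forall>n. t n < t0) \<longrightarrow>
            weak_star_lim (\<lambda>n. y (t n)) \<eta> sequentially \<longrightarrow>
            (\<lambda>n. \<langle>Ax (y (t n)), y (t n)\<rangle>) \<longlonglongrightarrow> \<langle>Ax \<eta>, \<eta>\<rangle>)) \<and>
    ((\<forall>\<eta> \<eta>'. linearised_VI_solution (Ap q) Ax Q \<eta> \<longrightarrow>
             linearised_VI_solution (Ap q) Ax Q \<eta>' \<longrightarrow> \<eta> = \<eta>') \<longrightarrow>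
       (\<exists>!\<eta>. weak_star_lim y \<eta> (at_right 0) \<and>
             ((\<lambda>t. \<langle>Ax (y t), y t\<rangle>) \<longlongrightarrow> \<langle>Ax \<eta>, \<eta>\<rangle>) (at_right 0)) \<and>
       (\<forall>\<eta>. weak_star_lim y \<eta> (at_right 0) \<and>
             ((\<lambda>t. \<langle>Ax (y t), y t\<rangle>) \<longlongrightarrow> \<langle>Ax \<eta>, \<eta>\<rangle>) (at_right 0) \<longrightarrow>
            linearised_VI_solution (Ap q) Ax Q \<eta>))"
proof -
  have x0: "xb 0 \<in> edom j"
    using sol0 by (simp add: VI_solutions_def)
  have a0': "A 0 (xb 0) = - a0" by (simp add: a0)
  have lsc: "weak_star_weak_continuous_lsc Ax"
    using cases completely_continuous_imp_weak_star_weak_continuous_lsc by blast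
  have y_bound: "norm (y t) \<le> L" if "0 < t" "t < t0" for t
    using Lip[of t] that by (simp add: y pos_divide_le_eq)
  have step: "xb 0 + t *\<^sub>R y t = xb t" if "0 < t" for t
    using that by (simp add: y)
  \<comment> \<open>The remainder divided by \<open>t\<close> is absorbed into the data, so that the
    expansion takes the exact form \<open>t *\<^sub>R (b t + Ax (y t)) - a0\<close>;
    \<open>b t\<close> still tends to \<open>Ap q\<close>.\<close>
  define b where "b = (\<lambda>t. Ap (qt t) + (1 / t) *\<^sub>R r t)"
  have VI: "ereal \<langle>b t + Ax (y t), y t\<rangle> + ereal (1/2) * second_quot j (xb 0) a0 t (y t)
      \<le> ereal \<langle>b t + Ax (y t), z\<rangle> + ereal (1/2) * second_quot j (xb 0) a0 t z"
    if t: "0 < t" "t < t0" for t z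
  proof (rule VI_second_quot[OF j x0 _ t(1)])
    show "xb 0 + t *\<^sub>R y t \<in> VI_solutions j A (t *\<^sub>R qt t)"
      using sol[OF t] by (simp add: step t)
    show "A (t *\<^sub>R qt t) (xb 0 + t *\<^sub>R y t) = t *\<^sub>R (b t + Ax (y t)) - a0"
      using t(1) by (simp add: expansion[OF t] a0' b_def scaleR_add_right)
  qed
  have b_lim: "(b \<longlongrightarrow> Ap q) (at_right 0)"
  proof -
    have "((\<lambda>t. (1 / t) *\<^sub>R r t) \<longlongrightarrow> 0) (at_right 0)"
    proof (rule Lim_null_comparison[OF _ remainder])
      show "\<forall>\<^sub>F t in at_right 0. norm ((1 / t) *\<^sub>R r t) \<le> norm (r t) / t"
        using eventually_at_right_less by eventually_elim simp
    qed
    then have "(b \<longlongrightarrow> Ap q + 0) (at_right 0)"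
      unfolding b_def by (intro tendsto_add tendsto_intros q_lim)
    then show ?thesis by simp
  qed
  have at_right: "filterlim t (at_right 0) sequentially" if "pos_null_seq t" for t
    using that by (auto simp: pos_null_seq_def filterlim_at less_imp_neq[symmetric] intro!: always_eventually)
  have subseq: "\<exists>\<eta> s. strict_mono (s :: nat \<Rightarrow> nat) \<and> weak_star_lim (\<lambda>n. y (t (s n))) \<eta> sequentially"
    if t: "pos_null_seq t" "\<forall>n. t n < t0" for t
  proof -
    have "norm (y (t n)) \<le> L" for n
      using t by (intro y_bound) (auto simp: pos_null_seq_def)
    then show ?thesis
      by (rule weak_star_sequentially_compact[OF Y, where x = "\<lambda>n. y (t n)"]) blast
  qed
  have null_subseq: "pos_null_seq (\<lambda>n. t (s n))" if "pos_null_seq t" "strict_mono s" for t s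
    using that LIMSEQ_subseq_LIMSEQ[of t 0 s] unfolding pos_null_seq_def o_def by blast
  have main: "linearised_VI_solution (Ap q) Ax Q \<eta>"
    "(\<lambda>n. \<langle>Ax (y (t n)), y (t n)\<rangle>) \<longlonglongrightarrow> \<langle>Ax \<eta>, \<eta>\<rangle>"
    if t: "pos_null_seq t" "\<forall>n. t n < t0" and \<eta>: "weak_star_lim (\<lambda>n. y (t n)) \<eta> sequentially"
    for t \<eta>
  proof -
    have tn: "0 < t n" "t n < t0" for n
      using t by (auto simp: pos_null_seq_def)
    have ws: "weak_lim (\<lambda>n. Ax (y (t n))) (Ax \<eta>) sequentially"
      and liminf: "ereal \<langle>Ax \<eta>, \<eta>\<rangle> \<le> liminf (\<lambda>n. ereal \<langle>Ax (y (t n)), y (t n)\<rangle>)"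
      using lsc \<eta> by (auto simp: weak_star_weak_continuous_lsc_def)
    \<comment> \<open>The two cases of the theorem differ here: a weak-star recovery sequence is
      paired with norm convergent images under \<open>Ax\<close>, a strong one with merely weakly
      convergent images, whose bound comes from the Lipschitz estimate.\<close>
    have recovery: "\<exists>zs. weak_star_lim zs z sequentially \<and>
        (\<lambda>n. \<langle>Ax (y (t n)), zs n\<rangle>) \<longlonglongrightarrow> \<langle>Ax \<eta>, z\<rangle> \<and>
        (\<lambda>n. second_quot j (xb 0) a0 (t n) (zs n)) \<longlonglongrightarrow> Q z" for z
      using cases
    proof (elim disjE conjE)
      assume "weak_star_twice_epi_diff j (xb 0) a0" "weak_star_completely_continuous Ax"
      then obtain zs where "weak_star_lim zs z sequentially"
        "(\<lambda>n. second_quot j (xb 0) a0 (t n) (zs n)) \<longlonglongrightarrow> Q z"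
        using t(1) by (auto simp: weak_star_twice_epi_diff_def Q)
      moreover have "(\<lambda>n. Ax (y (t n))) \<longlonglongrightarrow> Ax \<eta>"
        using \<open>weak_star_completely_continuous Ax\<close> \<eta>
        by (simp add: weak_star_completely_continuous_def)
      ultimately show ?thesis
        using tendsto_pairing by blast
    next
      assume "strong_twice_epi_diff j (xb 0) a0"
      then obtain zs where zs: "zs \<longlonglongrightarrow> z"
        "(\<lambda>n. second_quot j (xb 0) a0 (t n) (zs n)) \<longlonglongrightarrow> Q z"
        using t(1) by (auto simp: strong_twice_epi_diff_def Q)
      have "norm (Ax (y (t n))) \<le> norm Ax * L" for n
        by (intro order_trans[OF norm_blinfun mult_left_mono[OF y_bound[OF tn]]]) simp
      then have "(\<lambda>n. \<langle>Ax (y (t n)), zs n\<rangle>) \<longlonglongrightarrow> \<langle>Ax \<eta>, z\<rangle>"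
        by (rule tendsto_pairing_weak[OF ws _ zs(1)])
      then show ?thesis
        using zs weak_star_lim_norm by blast
    qed
    have "(\<lambda>n. b (t n)) \<longlonglongrightarrow> Ap q"
      using b_lim at_right[OF t(1)] by (rule filterlim_compose)
    note limit = linearised_VI_limit[OF VI[OF tn] this \<eta> liminf _ _ _ recovery]
    have Q_props: "0 \<le> Q z" "Q 0 \<le> 0" "Q \<eta> \<le> liminf (\<lambda>n. second_quot j (xb 0) a0 (t n) (y (t n)))" for z
      unfolding Q using second_subderiv_nonneg[OF j sol0 a0'] second_subderiv_0_le[OF x0]
        second_subderiv_le[OF t(1) \<eta>] by auto
    show "linearised_VI_solution (Ap q) Ax Q \<eta>"
      "(\<lambda>n. \<langle>Ax (y (t n)), y (t n)\<rangle>) \<longlonglongrightarrow> \<langle>Ax \<eta>, \<eta>\<rangle>"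
      by (rule limit; fact Q_props)+
  qed
  \<comment> \<open>Any concrete null sequence in the parameter interval yields a first accumulation
    point \<open>\<eta>0\<close>, the candidate for the full limit.\<close>
  define \<tau> where "\<tau> = (\<lambda>n. t0 * inverse (real (Suc (Suc n))))"
  have \<tau>: "pos_null_seq \<tau>" "\<forall>n. \<tau> n < t0"
    using pos_null_seq_inverse[OF t0] t0 by (auto simp: \<tau>_def field_simps add_pos_nonneg)
  obtain \<eta>0 s0 where s0: "strict_mono s0" "weak_star_lim (\<lambda>n. y (\<tau> (s0 n))) \<eta>0 sequentially"
    using subseq[OF \<tau>] by (elim exE conjE) (rule that)
  have acc: "weak_star_acc_point t0 y \<eta>0"
    unfolding weak_star_acc_point_def using null_subseq[OF \<tau>(1) s0(1)] \<tau>(2) s0(2)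
    by (intro exI[of _ "\<lambda>n. \<tau> (s0 n)"]) simp
  have full: "weak_star_lim y \<eta>0 (at_right 0) \<and>
      ((\<lambda>t. \<langle>Ax (y t), y t\<rangle>) \<longlongrightarrow> \<langle>Ax \<eta>0, \<eta>0\<rangle>) (at_right 0)"
    if unique: "\<forall>\<eta> \<eta>'. linearised_VI_solution (Ap q) Ax Q \<eta> \<longrightarrow>
      linearised_VI_solution (Ap q) Ax Q \<eta>' \<longrightarrow> \<eta> = \<eta>'"
  proof -
    have \<eta>0: "linearised_VI_solution (Ap q) Ax Q \<eta>0"
      using main(1)[OF null_subseq[OF \<tau>(1) s0(1)] _ s0(2)] \<tau>(2) by blast
    \<comment> \<open>Every null sequence has a subsequence along which the quotients converge
      weak-star. The limit solves the linearised inequality, so uniqueness identifies it with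
      \<open>\<eta>0\<close>.\<close>
    have ex: "\<exists>s. strict_mono (s :: nat \<Rightarrow> nat) \<and> weak_star_lim (\<lambda>n. y (t (s n))) \<eta>0 sequentially \<and>
        (\<lambda>n. \<langle>Ax (y (t (s n))), y (t (s n))\<rangle>) \<longlonglongrightarrow> \<langle>Ax \<eta>0, \<eta>0\<rangle>"
      if t: "pos_null_seq t" "\<forall>n. t n < t0" for t
    proof -
      obtain \<eta> s where s: "strict_mono s" "weak_star_lim (\<lambda>n. y (t (s n))) \<eta> sequentially"
        using subseq[OF t] by (elim exE conjE) (rule that)
      have ts: "pos_null_seq (\<lambda>n. t (s n))" "\<forall>n. t (s n) < t0"
        using null_subseq[OF t(1) s(1)] t(2) by auto
      have "\<eta> = \<eta>0"
        using unique main(1)[OF ts s(2)] \<eta>0 by blast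
      then show ?thesis
        using s main(2)[OF ts s(2)] by (intro exI[of _ s]) simp
    qed
    show ?thesis
      unfolding weak_star_lim_iff
    proof (intro conjI allI tendsto_at_right_subseqI[OF t0])
      fix v t assume "pos_null_seq t" "\<forall>n. t n < t0"
      from ex[OF this] show "\<exists>s. strict_mono (s :: nat \<Rightarrow> nat) \<and> (\<lambda>n. \<langle>v, y (t (s n))\<rangle>) \<longlonglongrightarrow> \<langle>v, \<eta>0\<rangle>"
        by (elim exE conjE) (intro exI conjI weak_star_limD)
    next
      fix t assume "pos_null_seq t" "\<forall>n. t n < t0"
      from ex[OF this] show "\<exists>s. strict_mono (s :: nat \<Rightarrow> nat) \<and>
          (\<lambda>n. \<langle>Ax (y (t (s n))), y (t (s n))\<rangle>) \<longlonglongrightarrow> \<langle>Ax \<eta>0, \<eta>0\<rangle>"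
        by blast
    qed
  qed
  \<comment> \<open>A limit of the whole family is in particular the limit along \<tau>, so the
    sequential result applies to it.\<close>
  have limit_solves: "linearised_VI_solution (Ap q) Ax Q \<eta>"
    if "weak_star_lim y \<eta> (at_right 0)" for \<eta>
  proof (rule main(1)[OF \<tau>])
    show "weak_star_lim (\<lambda>n. y (\<tau> n)) \<eta> sequentially"
      unfolding weak_star_lim_iff
      by (intro allI filterlim_compose[OF weak_star_limD[OF that] at_right[OF \<tau>(1)]])
  qed
  show ?thesis
  proof (intro conjI allI impI)
    show "\<exists>\<eta>. weak_star_acc_point t0 y \<eta>" using acc by blast
  next
    fix \<eta> assume "weak_star_acc_point t0 y \<eta>"
    then show "linearised_VI_solution (Ap q) Ax Q \<eta>"
      unfolding weak_star_acc_point_def by (elim exE conjE) (rule main(1))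
  next
    fix \<eta> t assume "pos_null_seq t" "\<forall>n. t n < t0" "weak_star_lim (\<lambda>n. y (t n)) \<eta> sequentially"
    then show "(\<lambda>n. \<langle>Ax (y (t n)), y (t n)\<rangle>) \<longlonglongrightarrow> \<langle>Ax \<eta>, \<eta>\<rangle>" by (rule main(2))
  next
    assume "\<forall>\<eta> \<eta>'. linearised_VI_solution (Ap q) Ax Q \<eta> \<longrightarrow>
      linearised_VI_solution (Ap q) Ax Q \<eta>' \<longrightarrow> \<eta> = \<eta>'"
    from full[OF this]
    show "\<exists>!\<eta>. weak_star_lim y \<eta> (at_right 0) \<and>
        ((\<lambda>t. \<langle>Ax (y t), y t\<rangle>) \<longlongrightarrow> \<langle>Ax \<eta>, \<eta>\<rangle>) (at_right 0)"
      using weak_star_lim_unique[OF _ _ trivial_limit_at_right_real] by (intro ex1I) blast+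
  next
    fix \<eta> assume "weak_star_lim y \<eta> (at_right 0) \<and>
        ((\<lambda>t. \<langle>Ax (y t), y t\<rangle>) \<longlongrightarrow> \<langle>Ax \<eta>, \<eta>\<rangle>) (at_right 0)"
    then show "linearised_VI_solution (Ap q) Ax Q \<eta>"
      using limit_solves by blast
  qed
qed

end
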